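(* Let $n\ge 1$ and let $\bm{\phi}=(\phi_0,\dots,\phi_{k-1})$ be a sequence of compactly supported contactomorphisms of either $(\mathbb{R}^{2n+1},\xi_0)$ or $(\mathbb{R}^{2n}\times S^1,\xi_0)$ contact isotopic to the identity, and let $\bm{p}_1$ and $\bm{p}_2$ be periodic translated chains of $\bm{\phi}$ with respect to $\alpha_0$ of periods $m_1$ and $m_2$ respectively. Assume that $$\frac{1}{m_1}\,\mathcal{A}_{\bm{\phi}^{m_1}}(\bm{p}_1)\neq\frac{1}{m_2}\,\mathcal{A}_{\bm{\phi}^{m_2}}(\bm{p}_2).$$ Then $\bm{p}_1$ and $\bm{p}_2$ are geometrically distinct.
   Context: Notation. $\mathbb{R}^{2n+1}$ has coordinates $(x_1,y_1,\dots,x_n,y_n,\theta)$ and contact form $\alpha_0=d\theta+\sum_{j=1}^n\frac{x_j\,dy_j-y_j\,dx_j}{2}$; $\mathbb{R}^{2n}\times S^1$, with $S^1=\mathbb{R}/\mathbb{Z}$, carries the induced form, still denoted $\alpha_0$; $\xi_0=\ker\alpha_0$. The Reeb flow is $\varphi^{\alpha_0}_t(x,y,\theta)=(x,y,\theta+t)$. The conformal factor of a contactomorphism $\phi$ is the function $g$ with $\phi^*\alpha_0=e^g\alpha_0$. Translated chains. A translated chain of a sequence $\bm{\phi}=(\phi_0,\dots,\phi_{k-1})$ of contactomorphisms, with conformal factors $g_j$, is a $k$-tuple $\bm{p}=(p_0,\dots,p_{k-1})$ of points such that $g_0(p_0)+\dots+g_{k-1}(p_{k-1})=0$ and, for some real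 numbers $t_0,\dots,t_{k-1}$, $p_{j+1}=\varphi^{\alpha_0}_{-t_j}\circ\phi_j(p_j)$ for all $j\in\mathbb{Z}_k$ (indices modulo $k$). Action. In $\mathbb{R}^{2n+1}$ the numbers $t_j$ are unique and the action of $\bm{p}$ is $\mathcal{A}_{\bm{\phi}}(\bm{p})=\sum_{j=0}^{k-1}t_j$. In $\mathbb{R}^{2n}\times S^1$, let $(\phi_j)_{\mathbb{R}}$ be the lift of $\phi_j$ to $\mathbb{R}^{2n+1}$ which is the identity over the complement of the support of $\phi_j$, and let $\bm{\phi}_{\mathbb{R}}=((\phi_0)_{\mathbb{R}},\dots,(\phi_{k-1})_{\mathbb{R}})$; then $\mathcal{A}_{\bm{\phi}}(\bm{p})=\mathcal{A}_{\bm{\phi}_{\mathbb{R}}}(\bm{p}_{\mathbb{R}})$ for any $k$-tuple $\bm{p}_{\mathbb{R}}$ of points of $\mathbb{R}^{2n+1}$ projecting to $\bm{p}$ (this does not depend on the choice of $\bm{p}_{\mathbb R}$). Iterations. $\bm{\phi}^m=(\bm{\phi},\dots,\bm{\phi})$ ($m$ copies) is the concatenated sequence of length $mk$. A periodic translated chain of $\bm{\phi}$ of period $m$ is a translated chain of $\bm{\phi}^m$; it is written $(\bm{p}_0,\dots,\bm{p}_{m-1})$ with each $\bm{p}_i$ a $k$-tuple. Two periodic translated chains are geometrically distinct if they are not equivalent for the equivalence relation generated by cyclic permutation, $(\bm{p}_0,\dots,\bm{p}_{m-1})\mapsto(\bm{p}_1,\dots,\bm{p}_{m-1},\bm{p}_0)$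 for a chain of period $m$, and iteration, $\bm{p}\mapsto\bm{p}^l=(\bm{p},\dots,\bm{p})$ ($l$ copies, $l\ge 1$). *)

theory Defs
  imports "HOL-Analysis.Analysis"
begin

section \<open>The circle \<open>\<real>/\<int>\<close>\<close>

quotient_type circle = real / "\<lambda>s t :: real. s - t \<in> \<int>"
proof (rule equivpI)
  show "reflp (\<lambda>s t :: real. s - t \<in> \<int>)"
    by (simp add: reflp_def)
  show "symp (\<lambda>s t :: real. s - t \<in> \<int>)"
    by (metis (no_types, lifting) Ints_minus minus_diff_eq sympI)
  show "transp (\<lambda>s t :: real. s - t \<in> \<int>)"
    by (rule transpI) (metis (no_types, lifting) Ints_add diff_add_cancel add_diff_eq)
qed

instantiation circle :: ab_group_add
begin

lift_definition zero_circle :: circle is "0 :: real" .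

lift_definition plus_circle :: "circle \<Rightarrow> circle \<Rightarrow> circle" is "(+) :: real \<Rightarrow> real \<Rightarrow> real"
  by (metis (no_types, lifting) Ints_add add_diff_add)

lift_definition uminus_circle :: "circle \<Rightarrow> circle" is "uminus :: real \<Rightarrow> real"
  by (metis (no_types, lifting) Ints_minus minus_diff_minus)

lift_definition minus_circle :: "circle \<Rightarrow> circle \<Rightarrow> circle" is "(-) :: real \<Rightarrow> real \<Rightarrow> real"
  by (metis (no_types, lifting) Ints_diff diff_diff_eq2 diff_add_eq add_diff_eq diff_diff_eq
      add.commute)

instance
  by standard (transfer, simp add: algebra_simps)+

end

text \<open>The quotient topology.\<close>

instantiation circle :: topological_space
begin

definition open_circle :: "circle set \<Rightarrow> bool" where
  "open_circle U \<longleftrightarrow> open (abs_circle -` U)"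

instance
  by standard (auto simp: open_circle_def vimage_Union intro!: open_Int open_UN)

end


section \<open>The two contact manifolds\<close>

text \<open>
  A point \<open>(x, y, \<theta>)\<close> has \<open>x, y\<close> in \<open>\<real>\<^sup>n\<close>, where \<open>n\<close> is the (positive) cardinality of the index
  type, and \<open>\<theta>\<close> in \<open>\<real>\<close> or in the circle. The class below lets both cases share all definitions: each
  manifold is the quotient of \<open>\<real>\<^sup>2\<^sup>n\<^sup>+\<^sup>1\<close> by a discrete group of translations in \<open>\<theta>\<close> (the trivial one, or
  the integers), and the quotient map is a local diffeomorphism whose local inverses are the charts.
\<close>

class theta_coordinate = topological_space + ab_group_add +
  fixes theta_class :: "real \<Rightarrow> 'a"

instantiation real :: theta_coordinate
begin
definition theta_class_real :: "real \<Rightarrow> real" where "theta_class_real = id"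
instance ..
end

instantiation circle :: theta_coordinate
begin
definition theta_class_circle :: "real \<Rightarrow> circle" where "theta_class_circle = abs_circle"
instance ..
end

type_synonym ('n, 'c) space = "(real ^ 'n) \<times> (real ^ 'n) \<times> 'c"

definition proj :: "('n::finite, real) space \<Rightarrow> ('n, 'c::theta_coordinate) space" where
  "proj = (\<lambda>(x, y, \<theta>). (x, y, theta_class \<theta>))"

definition reeb_flow ::
  "real \<Rightarrow> ('n::finite, 'c::theta_coordinate) space \<Rightarrow> ('n, 'c) space" where
  "reeb_flow t = (\<lambda>(x, y, \<theta>). (x, y, \<theta> + theta_class t))"

text \<open>\<open>alpha0 p\<close> is the contact form of \<open>\<real>\<^sup>2\<^sup>n\<^sup>+\<^sup>1\<close> at \<open>p\<close>. It does not depend on the \<open>\<theta>\<close>-coordinate of \<open>p\<close>,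
  so it is also the expression of the induced form in the charts of \<open>\<real>\<^sup>2\<^sup>n \<times> S\<^sup>1\<close>.\<close>

definition alpha0 :: "('n::finite, real) space \<Rightarrow> ('n, real) space \<Rightarrow> real" where
  "alpha0 = (\<lambda>(x, y, \<theta>) (dx, dy, d\<theta>). d\<theta> + (\<Sum>j\<in>UNIV. (x $ j * dy $ j - y $ j * dx $ j) / 2))"

definition xi0 :: "('n::finite, real) space \<Rightarrow> ('n, real) space set" where
  "xi0 p = {v. alpha0 p v = 0}"


section \<open>Contactomorphisms\<close>

text \<open>Being of class \<open>C\<^sup>k\<close> on an open subset of a finite-dimensional space.\<close>

primrec Ck_on ::
  "nat \<Rightarrow> 'a::euclidean_space set \<Rightarrow> ('a \<Rightarrow> 'b::euclidean_space) \<Rightarrow> bool" where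
  "Ck_on 0 U f \<longleftrightarrow> continuous_on U f"
| "Ck_on (Suc k) U f \<longleftrightarrow> (\<forall>x\<in>U. f differentiable at x) \<and>
     (\<forall>v. Ck_on k U (\<lambda>x. frechet_derivative f (at x) v))"

definition smooth_on :: "'a::euclidean_space set \<Rightarrow> ('a \<Rightarrow> 'b::euclidean_space) \<Rightarrow> bool" where
  "smooth_on U f \<longleftrightarrow> open U \<and> (\<forall>k. Ck_on k U f)"

text \<open>\<open>F\<close> is a smooth expression of \<open>f\<close> in the charts.\<close>

definition local_expression ::
  "(('n::finite, 'c::theta_coordinate) space \<Rightarrow> ('n, 'c) space) \<Rightarrow>
   ('n, real) space set \<Rightarrow> (('n, real) space \<Rightarrow> ('n, real) space) \<Rightarrow> bool" where
  "local_expression f U F \<longleftrightarrow> smooth_on U F \<and> (\<forall>q\<in>U. proj (F q) = f (proj q))"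

definition smooth_map ::
  "(('n::finite, 'c::theta_coordinate) space \<Rightarrow> ('n, 'c) space) \<Rightarrow> bool" where
  "smooth_map f \<longleftrightarrow> (\<forall>q. \<exists>U F. q \<in> U \<and> local_expression f U F)"

definition contactomorphism ::
  "(('n::finite, 'c::theta_coordinate) space \<Rightarrow> ('n, 'c) space) \<Rightarrow> bool" where
  "contactomorphism f \<longleftrightarrow> bij f \<and> smooth_map f \<and> smooth_map (inv f) \<and>
     (\<forall>U F. local_expression f U F \<longrightarrow>
        (\<forall>q\<in>U. frechet_derivative F (at q) ` xi0 q = xi0 (F q)))"

definition is_conformal_factor ::
  "(('n::finite, 'c::theta_coordinate) space \<Rightarrow> ('n, 'c) space) \<Rightarrow>
   (('n, 'c) space \<Rightarrow> real) \<Rightarrow> bool" where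
  "is_conformal_factor f g \<longleftrightarrow> (\<forall>U F. local_expression f U F \<longrightarrow>
     (\<forall>q\<in>U. \<forall>v. alpha0 (F q) (frechet_derivative F (at q) v) = exp (g (proj q)) * alpha0 q v))"

definition conformal_factor ::
  "(('n::finite, 'c::theta_coordinate) space \<Rightarrow> ('n, 'c) space) \<Rightarrow> ('n, 'c) space \<Rightarrow> real" where
  "conformal_factor f = (THE g. is_conformal_factor f g)"

definition support :: "('a::topological_space \<Rightarrow> 'a) \<Rightarrow> 'a set" where
  "support f = closure {p. f p \<noteq> p}"

text \<open>An isotopy is a family over \<open>[0,1]\<close>, smooth in time and space jointly; as usual,
  smoothness at a point of \<open>[0,1] \<times> M\<close> means existence of a smooth extension to a neighbourhood.
  Isotopies are within the compactly supported contactomorphisms.\<close>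

definition contact_isotopic_to_id ::
  "(('n::finite, 'c::theta_coordinate) space \<Rightarrow> ('n, 'c) space) \<Rightarrow> bool" where
  "contact_isotopic_to_id f \<longleftrightarrow> (\<exists>h :: real \<Rightarrow> ('n, 'c) space \<Rightarrow> ('n, 'c) space.
     h 0 = id \<and> h 1 = f \<and>
     (\<forall>t\<in>{0..1}. contactomorphism (h t)) \<and>
     (\<exists>K. compact K \<and> (\<forall>t\<in>{0..1}. support (h t) \<subseteq> K)) \<and>
     (\<forall>t\<in>{0..1}. \<forall>q. \<exists>W (F :: real \<times> ('n, real) space \<Rightarrow> ('n, real) space).
        (t, q) \<in> W \<and> smooth_on W F \<and>
        (\<forall>(s, r)\<in>W. s \<in> {0..1} \<longrightarrow> proj (F (s, r)) = h s (proj r))))"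

definition admissible ::
  "(('n::finite, 'c::theta_coordinate) space \<Rightarrow> ('n, 'c) space) list \<Rightarrow> bool" where
  "admissible \<phi> \<longleftrightarrow> \<phi> \<noteq> [] \<and>
     (\<forall>f\<in>set \<phi>. contactomorphism f \<and> compact (support f) \<and> contact_isotopic_to_id f)"


section \<open>Translated chains and their action\<close>

definition translated_chain ::
  "(('n::finite, 'c::theta_coordinate) space \<Rightarrow> ('n, 'c) space) list \<Rightarrow>
   ('n, 'c) space list \<Rightarrow> bool" where
  "translated_chain \<phi> p \<longleftrightarrow> length p = length \<phi> \<and>
     (\<Sum>j<length \<phi>. conformal_factor (\<phi> ! j) (p ! j)) = 0 \<and>
     (\<exists>t :: nat \<Rightarrow> real. \<forall>j<length \<phi>.
        p ! (Suc j mod length \<phi>) = reeb_flow (- t j) ((\<phi> ! j) (p ! j)))"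

definition action ::
  "(('n::finite, real) space \<Rightarrow> ('n, real) space) list \<Rightarrow> ('n, real) space list \<Rightarrow> real" where
  "action \<phi> p = (\<Sum>j<length \<phi>.
     (THE t. p ! (Suc j mod length \<phi>) = reeb_flow (- t) ((\<phi> ! j) (p ! j))))"

text \<open>
  The lift of a compactly supported map of \<open>\<real>\<^sup>2\<^sup>n \<times> S\<^sup>1\<close>, normalised by being the identity over the
  complement of a compact set. If some lift is the identity over the whole complement of the support,
  it is this one. Asking for the latter would be too much: if a compactly supported contact
  Hamiltonian depends only on \<open>|(x, y)|\<close> and equals 1 on a neighbourhood of \<open>{0} \<times> S\<^sup>1\<close>, then its
  time-one map is the identity there, but the lift that is the identity far away is the translation
  \<open>\<theta> \<mapsto> \<theta> + 1\<close> there.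
\<close>

definition real_lift ::
  "(('n::finite, circle) space \<Rightarrow> ('n, circle) space) \<Rightarrow>
   ('n, real) space \<Rightarrow> ('n, real) space" where
  "real_lift f = (THE F. continuous_on UNIV F \<and> (\<forall>q. proj (F q) = f (proj q)) \<and>
     (\<exists>K :: ('n, circle) space set. compact K \<and> (\<forall>q. proj q \<notin> K \<longrightarrow> F q = q)))"

definition action_circle ::
  "(('n::finite, circle) space \<Rightarrow> ('n, circle) space) list \<Rightarrow> ('n, circle) space list \<Rightarrow> real" where
  "action_circle \<phi> p = (THE a. \<forall>q. map proj q = p \<longrightarrow> action (map real_lift \<phi>) q = a)"


section \<open>Periodic translated chains\<close>

definition iterate :: "nat \<Rightarrow> 'a list \<Rightarrow> 'a list" where
  "iterate m xs = concat (replicate m xs)"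

text \<open>A periodic translated chain of period \<open>m\<close> is kept as a list of \<open>m\<close> tuples of length \<open>k\<close>.\<close>

definition periodic_translated_chain ::
  "(('n::finite, 'c::theta_coordinate) space \<Rightarrow> ('n, 'c) space) list \<Rightarrow> nat \<Rightarrow>
   ('n, 'c) space list list \<Rightarrow> bool" where
  "periodic_translated_chain \<phi> m P \<longleftrightarrow> m \<ge> 1 \<and> length P = m \<and>
     (\<forall>p\<in>set P. length p = length \<phi>) \<and> translated_chain (iterate m \<phi>) (concat P)"

definition rotation_or_iteration ::
  "(('n::finite, 'c::theta_coordinate) space \<Rightarrow> ('n, 'c) space) list \<Rightarrow>
   ('n, 'c) space list list \<Rightarrow> ('n, 'c) space list list \<Rightarrow> bool" where
  "rotation_or_iteration \<phi> P Q \<longleftrightarrow> (\<exists>m. periodic_translated_chain \<phi> m P) \<and>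
     (Q = rotate1 P \<or> (\<exists>l\<ge>1. Q = iterate l P))"

definition geometrically_distinct ::
  "(('n::finite, 'c::theta_coordinate) space \<Rightarrow> ('n, 'c) space) list \<Rightarrow>
   ('n, 'c) space list list \<Rightarrow> ('n, 'c) space list list \<Rightarrow> bool" where
  "geometrically_distinct \<phi> P Q \<longleftrightarrow> \<not> equivclp (rotation_or_iteration \<phi>) P Q"

end

theory Submission
  imports Defs
begin

text \<open>
  The mean action \<open>(1 / m) * action (iterate m \<phi>) p\<close> of a periodic chain is invariant under the two
  moves that generate geometric equivalence, hence constant on every equivalence class; the theorem
  is the contrapositive.

  Over \<open>\<real>\<^sup>2\<^sup>n\<^sup>+\<^sup>1\<close> the action is a sum over the cyclically ordered indices, whose \<open>j\<close>-th term depends only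
  on \<open>\<phi>\<^sub>j\<close>, \<open>p\<^sub>j\<close> and \<open>p\<^sub>j\<^sub>+\<^sub>1\<close>. A cyclic permutation reorders the terms
  (\<open>action_rotate\<close>), and passing to the \<open>l\<close>-th iterate repeats each of them \<open>l\<close> times
  (\<open>action_iterate\<close>), which the factor \<open>1 / m\<close> compensates.

  Over \<open>\<real>\<^sup>2\<^sup>n \<times> S\<^sup>1\<close> the same computation applies to a lift of the chain, once the action of lifts is known
  not to depend on the lift (\<open>action_lift_independent\<close>). In a chain, \<open>p\<^sub>j\<^sub>+\<^sub>1\<close> and \<open>\<phi>\<^sub>j p\<^sub>j\<close> differ
  by a translation in \<open>\<theta>\<close>, so the action regroups to \<open>\<Sum>\<^sub>j (\<theta> (F\<^sub>j q\<^sub>j) - \<theta> q\<^sub>j)\<close>, where the \<open>F\<^sub>j\<close> are the lifted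
  maps. Each term is unchanged when \<open>q\<^sub>j\<close> moves by an integer, because \<open>F\<^sub>j\<close> commutes with integer
  translations. That property comes from the uniqueness of the lift which is the identity at
  infinity, and existence comes from lifting the isotopy to the identity
  (\<open>ex_compact_lift\<close>): off the compact set that contains all the supports, the lifted isotopy
  cannot leave its starting point, since it moves within a discrete fibre.
\<close>

section \<open>Rotating and iterating the action of a sequence\<close>

lemma sum_cyclic_shift:
  fixes f :: "nat \<Rightarrow> 'a::comm_monoid_add"
  shows "(\<Sum>j<N. f (Suc j mod N)) = (\<Sum>j<N. f j)"
proof (cases N)
  case (Suc M)
  have "(\<Sum>j<N. f (Suc j mod N)) = (\<Sum>j<M. f (Suc j)) + f 0"
    unfolding Suc by (simp add: sum.lessThan_Suc cong: sum.cong_simp)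
  also have "\<dots> = (\<Sum>j<N. f j)"
    unfolding Suc by (simp only: sum.lessThan_Suc_shift add.commute)
  finally show ?thesis .
qed simp

lemma sum_mod_repeat:
  fixes f :: "nat \<Rightarrow> real"
  shows "(\<Sum>j<l * N. f (j mod N)) = real l * (\<Sum>j<N. f j)"
proof -
  have "(\<Sum>j<l * N. f (j mod N)) = (\<Sum>i<l. sum (\<lambda>j. f (j mod N)) {i * N..<i * N + N})"
    by (simp add: sum.nat_group)
  also have "\<dots> = (\<Sum>i<l. \<Sum>j<N. f j)"
  proof (rule sum.cong[OF refl])
    fix i
    have "sum (\<lambda>j. f (j mod N)) {i * N..<i * N + N}
        = sum (\<lambda>j. f ((j + i * N) mod N)) {0..<N}"
      using sum.shift_bounds_nat_ivl[of "\<lambda>j. f (j mod N)" 0 "i * N" N]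
      by (simp add: add.commute)
    also have "\<dots> = (\<Sum>j<N. f j)"
      by (simp add: atLeast0LessThan)
    finally show "sum (\<lambda>j. f (j mod N)) {i * N..<i * N + N} = (\<Sum>j<N. f j)" .
  qed
  finally show ?thesis by simp
qed

lemma length_iterate [simp]: "length (iterate m xs) = m * length xs"
  by (simp add: iterate_def length_concat sum_list_replicate)

lemma iterate_0 [simp]: "iterate 0 xs = []"
  and iterate_Suc: "iterate (Suc m) xs = xs @ iterate m xs"
  by (simp_all add: iterate_def)

lemma iterate_append_commute: "iterate m xs @ xs = xs @ iterate m xs"
  by (induction m) (simp_all add: iterate_Suc)

lemma iterate_add: "iterate (l + m) xs = iterate l xs @ iterate m xs"
  by (induction l) (simp_all add: iterate_Suc)

lemma iterate_iterate: "iterate l (iterate m xs) = iterate (l * m) xs"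
  by (induction l) (simp_all add: iterate_Suc iterate_add)

lemma map_iterate: "map f (iterate m xs) = iterate m (map f xs)"
  by (induction m) (simp_all add: iterate_Suc)

lemma concat_iterate: "concat (iterate l P) = iterate l (concat P)"
  by (induction l) (simp_all add: iterate_Suc)

lemma set_iterate_subset: "set (iterate m xs) \<subseteq> set xs"
  by (induction m) (auto simp: iterate_Suc)

lemma nth_iterate:
  "j < l * length xs \<Longrightarrow> iterate l xs ! j = xs ! (j mod length xs)"
proof (induction l arbitrary: j)
  case (Suc l)
  show ?case
  proof (cases "j < length xs")
    case False
    with Suc.prems have "j - length xs < l * length xs" by simp
    with False show ?thesis
      by (simp add: iterate_Suc nth_append Suc.IH le_mod_geq)
  qed (simp add: iterate_Suc nth_append)
qed simp

lemma rotate_iterate: "rotate (length xs) (iterate m xs) = iterate m xs"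
  by (cases m) (simp_all add: iterate_Suc rotate_append iterate_append_commute)

lemma concat_rotate1:
  assumes "\<forall>p\<in>set P. length p = k"
  shows "concat (rotate1 P) = rotate k (concat P)"
  using assms by (cases P) (auto simp: rotate_append)

lemma action_rotate1:
  assumes "length p = length \<phi>"
  shows "action (rotate1 \<phi>) (rotate1 p) = action \<phi> p"
proof -
  let ?N = "length \<phi>"
  let ?T = "\<lambda>j. THE t. p ! (Suc j mod ?N) = reeb_flow (- t) ((\<phi> ! j) (p ! j))"
  have "action (rotate1 \<phi>) (rotate1 p) = (\<Sum>j<?N. ?T (Suc j mod ?N))"
    unfolding action_def
  proof (simp only: length_rotate1, rule sum.cong[OF refl])
    fix j assume "j \<in> {..<?N}"
    then have "j < ?N" "Suc j mod ?N < ?N" by (auto intro: mod_less_divisor)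
    then show "(THE t. rotate1 p ! (Suc j mod ?N)
            = reeb_flow (- t) ((rotate1 \<phi> ! j) (rotate1 p ! j))) = ?T (Suc j mod ?N)"
      by (simp add: nth_rotate1 assms)
  qed
  also have "\<dots> = (\<Sum>j<?N. ?T j)" by (rule sum_cyclic_shift)
  finally show ?thesis by (simp add: action_def)
qed

lemma action_rotate:
  assumes "length p = length \<phi>"
  shows "action (rotate i \<phi>) (rotate i p) = action \<phi> p"
  by (induction i) (simp_all add: assms action_rotate1)

lemma action_iterate:
  assumes len: "length p = length \<phi>"
  shows "action (iterate l \<phi>) (iterate l p) = real l * action \<phi> p"
proof -
  let ?N = "length \<phi>"
  let ?T = "\<lambda>j. THE t. p ! (Suc j mod ?N) = reeb_flow (- t) ((\<phi> ! j) (p ! j))"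
  have "action (iterate l \<phi>) (iterate l p) = (\<Sum>j<l * ?N. ?T (j mod ?N))"
    unfolding action_def
  proof (simp only: length_iterate, rule sum.cong[OF refl])
    fix j assume "j \<in> {..<l * ?N}"
    then have j: "j < l * ?N" by simp
    then have j': "Suc j mod (l * ?N) < l * ?N" by (intro mod_less_divisor) linarith
    have "Suc j mod (l * ?N) mod ?N = Suc (j mod ?N) mod ?N"
      by (simp add: mod_mod_cancel mod_Suc_eq)
    with j j' show "(THE t. iterate l p ! (Suc j mod (l * ?N))
            = reeb_flow (- t) ((iterate l \<phi> ! j) (iterate l p ! j))) = ?T (j mod ?N)"
      by (simp add: nth_iterate len)
  qed
  also have "\<dots> = real l * (\<Sum>j<?N. ?T j)" by (rule sum_mod_repeat)
  finally show ?thesis by (simp add: action_def)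
qed

text \<open>Rotating a periodic chain by one tuple rotates its points by the length of the
  sequence, which leaves the iterated sequence unchanged.\<close>

lemma action_rotate1_tuples:
  assumes "\<forall>p\<in>set P. length p = length \<phi>" and "length P = m"
  shows "action (iterate m \<phi>) (concat (rotate1 P)) = action (iterate m \<phi>) (concat P)"
proof -
  have "length (concat P) = m * length \<phi>"
    using assms by (induction P arbitrary: m) auto
  then have "action (rotate (length \<phi>) (iterate m \<phi>)) (rotate (length \<phi>) (concat P))
      = action (iterate m \<phi>) (concat P)"
    by (intro action_rotate) simp
  then show ?thesis
    by (simp add: rotate_iterate concat_rotate1[OF assms(1)])
qed


section \<open>Lifts from \<open>\<real>\<^sup>2\<^sup>n \<times> S\<^sup>1\<close> to \<open>\<real>\<^sup>2\<^sup>n\<^sup>+\<^sup>1\<close>\<close>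

abbreviation theta :: "('n, 'c) space \<Rightarrow> 'c" where
  "theta p \<equiv> snd (snd p)"

definition compact_lift ::
  "(('n::finite, circle) space \<Rightarrow> ('n, circle) space) \<Rightarrow>
   (('n, real) space \<Rightarrow> ('n, real) space) \<Rightarrow> bool" where
  "compact_lift f F \<longleftrightarrow> continuous_on UNIV F \<and> (\<forall>q. proj (F q) = f (proj q)) \<and>
     (\<exists>K :: ('n, circle) space set. compact K \<and> (\<forall>q. proj q \<notin> K \<longrightarrow> F q = q))"

lemma real_lift_eq: "real_lift f = (THE F. compact_lift f F)"
  by (simp add: real_lift_def compact_lift_def)

lemma proj_sel:
  fixes q :: "('n::finite, real) space"
  shows "fst (proj q :: ('n, circle) space) = fst q"
    and "fst (snd (proj q :: ('n, circle) space)) = fst (snd q)"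
    and "theta (proj q :: ('n, circle) space) = abs_circle (theta q)"
  by (simp_all add: proj_def theta_class_circle_def split: prod.splits)

lemma reeb_flow_sel:
  "fst (reeb_flow t p) = fst p"
  "fst (snd (reeb_flow t p)) = fst (snd p)"
  "theta (reeb_flow t p) = theta p + theta_class t"
  by (simp_all add: reeb_flow_def split: prod.splits)

lemma reeb_flow_real:
  "reeb_flow t = (\<lambda>p :: ('n::finite, real) space. (fst p, fst (snd p), theta p + t))"
  by (auto simp: reeb_flow_def theta_class_real_def)

lemma proj_eq_iff:
  fixes q r :: "('n::finite, real) space"
  shows "(proj q :: ('n, circle) space) = proj r \<longleftrightarrow>
     fst q = fst r \<and> fst (snd q) = fst (snd r) \<and> theta q - theta r \<in> \<int>"
  by (simp add: prod_eq_iff proj_sel circle.abs_eq_iff)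

lemma proj_eq_iff_translate:
  fixes q r :: "('n::finite, real) space"
  shows "(proj q :: ('n, circle) space) = proj r \<longleftrightarrow> (\<exists>z\<in>\<int>. q = reeb_flow z r)"
proof
  assume "(proj q :: ('n, circle) space) = proj r"
  then have "theta q - theta r \<in> \<int>" "q = reeb_flow (theta q - theta r) r"
    unfolding proj_eq_iff
    by (simp_all add: reeb_flow_real prod_eq_iff)
  then show "\<exists>z\<in>\<int>. q = reeb_flow z r" by blast
qed (auto simp: proj_eq_iff reeb_flow_real)

lemma surj_proj: "\<exists>q. (proj q :: ('n::finite, circle) space) = p"
proof -
  obtain x y c where p: "p = (x, y, c)" by (cases p)
  have "abs_circle (rep_circle c) = c" by (rule Quotient3_abs_rep[OF Quotient3_circle])
  then have "proj (x, y, rep_circle c) = p"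
    by (simp add: p proj_def theta_class_circle_def)
  then show ?thesis by blast
qed

lemma continuous_Ints_valued_constant:
  fixes f :: "'a::topological_space \<Rightarrow> real"
  assumes "connected S" "continuous_on S f" "\<And>x. x \<in> S \<Longrightarrow> f x \<in> \<int>" "a \<in> S" "b \<in> S"
  shows "f a = f b"
proof -
  have "f constant_on S"
  proof (rule continuous_discrete_range_constant[OF assms(1,2)])
    fix x assume "x \<in> S"
    have "1 \<le> norm (f y - f x)" if "y \<in> S" "f y \<noteq> f x" for y
      using Ints_nonzero_abs_ge1[of "f y - f x"] assms(3) \<open>x \<in> S\<close> that by auto
    then show "\<exists>e>0. \<forall>y. y \<in> S \<and> f y \<noteq> f x \<longrightarrow> e \<le> norm (f y - f x)"
      by (intro exI[of _ 1]) auto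
  qed
  with assms(4,5) show ?thesis by (auto simp: constant_on_def)
qed

text \<open>Here \<open>n \<ge> 1\<close> enters: the projection of a compact set to the \<open>x\<close>-coordinates is bounded.\<close>

lemma ex_proj_notin_compact:
  fixes K :: "('n::finite, circle) space set"
  assumes "compact K"
  shows "\<exists>q. proj q \<notin> K"
proof -
  have "compact (fst ` K)"
    by (intro compact_continuous_image continuous_on_fst continuous_on_id assms)
  then have "fst ` K \<noteq> (UNIV :: (real ^ 'n) set)"
    using not_bounded_UNIV compact_imp_bounded by metis
  then obtain x where "x \<notin> fst ` K" by blast
  then have "proj (x, 0, 0) \<notin> K"
    by (force simp: proj_def)
  then show ?thesis by blast
qed

text \<open>Two lifts differ by a continuous integer-valued function, which vanishes near infinity.\<close>

lemma compact_lift_unique: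
  fixes f :: "('n::finite, circle) space \<Rightarrow> ('n, circle) space"
  assumes "compact_lift f F" "compact_lift f G"
  shows "F = G"
proof
  fix q
  obtain K L :: "('n, circle) space set"
    where K: "compact K" "\<forall>q. proj q \<notin> K \<longrightarrow> F q = q"
    and L: "compact L" "\<forall>q. proj q \<notin> L \<longrightarrow> G q = q"
    using assms unfolding compact_lift_def by blast
  obtain r where r: "proj r \<notin> K \<union> L"
    using ex_proj_notin_compact[OF compact_Un[OF K(1) L(1)]] by blast
  then have Fr: "F r = r" "G r = r" using K(2) L(2) by blast+
  have "(proj (F s) :: ('n, circle) space) = proj (G s)" for s
    using assms unfolding compact_lift_def by metis
  then have eq: "fst (F s) = fst (G s)" "fst (snd (F s)) = fst (snd (G s))"
    "theta (F s) - theta (G s) \<in> \<int>" for s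
    by (simp_all add: proj_eq_iff)
  have "theta (F q) - theta (G q) = theta (F r) - theta (G r)"
  proof (rule continuous_Ints_valued_constant[of UNIV "\<lambda>s. theta (F s) - theta (G s)"])
    have "continuous_on UNIV F" "continuous_on UNIV G"
      using assms by (auto simp only: compact_lift_def)
    then show "continuous_on UNIV (\<lambda>s. theta (F s) - theta (G s))"
      by (intro continuous_intros)
  qed (use eq(3) in auto)
  also have "\<dots> = 0" by (simp add: Fr)
  finally show "F q = G q" using eq[of q] by (simp add: prod_eq_iff)
qed

text \<open>Conjugating a lift by an integer translation gives another one, so uniqueness makes it
  commute with the translation.\<close>

lemma compact_lift_equivariant:
  fixes f :: "('n::finite, circle) space \<Rightarrow> ('n, circle) space"
  assumes F: "compact_lift f F" and z: "z \<in> \<int>"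
  shows "F (reeb_flow z q) = reeb_flow z (F q)"
proof -
  let ?G = "\<lambda>q. reeb_flow (- z) (F (reeb_flow z q))"
  have proj_reeb: "(proj (reeb_flow t p) :: ('n, circle) space) = proj p" if "t \<in> \<int>" for t p
    using that proj_eq_iff_translate by blast
  have cont: "continuous_on UNIV (reeb_flow t :: ('n, real) space \<Rightarrow> _)" for t
    unfolding reeb_flow_real by (intro continuous_intros)
  have "compact_lift f ?G"
    unfolding compact_lift_def
  proof (intro conjI allI)
    have "continuous_on UNIV F" using F by (simp add: compact_lift_def)
    then show "continuous_on UNIV ?G"
      by (intro continuous_on_compose2[OF cont] continuous_on_compose2[OF _ cont]) auto
    show "proj (?G q) = f (proj q)" for q
    proof -
      have "proj (F (reeb_flow z q)) = f (proj (reeb_flow z q))"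
        using F unfolding compact_lift_def by blast
      then show ?thesis using z by (simp only: proj_reeb Ints_minus)
    qed
    obtain K :: "('n, circle) space set"
      where K: "compact K" "\<forall>q. proj q \<notin> K \<longrightarrow> F q = q"
      using F unfolding compact_lift_def by blast
    have "?G q = q" if "proj q \<notin> K" for q
    proof -
      have "F (reeb_flow z q) = reeb_flow z q"
        using K(2)[rule_format, of "reeb_flow z q"] that z by (simp only: proj_reeb not_False_eq_True)
      then show ?thesis by (simp add: reeb_flow_real)
    qed
    with K(1) show "\<exists>K :: ('n, circle) space set. compact K \<and> (\<forall>q. proj q \<notin> K \<longrightarrow> ?G q = q)"
      by blast
  qed
  then have "?G = F" using F by (rule compact_lift_unique)
  then have "reeb_flow z (F q) = reeb_flow z (?G q)" by (metis (no_types, lifting))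
  also have "\<dots> = F (reeb_flow z q)" by (simp add: reeb_flow_real)
  finally show ?thesis ..
qed

lemma continuous_on_if_locally_eq:
  fixes f :: "'a::t2_space \<Rightarrow> 'b::topological_space"
  assumes "\<And>z. z \<in> S \<Longrightarrow>
    \<exists>W g. open W \<and> z \<in> W \<and> continuous_on W g \<and> (\<forall>w\<in>W \<inter> S. f w = g w)"
  shows "continuous_on S f"
  unfolding continuous_on_def
proof
  fix z assume z: "z \<in> S"
  then obtain W g where W: "open W" "z \<in> W" "continuous_on W g" "\<forall>w\<in>W \<inter> S. f w = g w"
    using assms by blast
  then have "isCont g z"
    using continuous_on_eq_continuous_at[of W g] by simp
  then have "(g \<longlongrightarrow> g z) (at z)"
    by (simp only: isCont_def)
  then have "(g \<longlongrightarrow> g z) (at z within S)"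
    by (rule tendsto_within_subset) simp
  moreover have "eventually (\<lambda>w. f w = g w) (at z within S)"
    using W unfolding eventually_at_topological by (intro exI[of _ W]) auto
  ultimately show "(f \<longlongrightarrow> f z) (at z within S)"
    using W(2,4) z by (simp add: tendsto_cong)
qed

text \<open>Used below with base \<open>[0,1] \<times> \<real>\<^sup>2\<^sup>n\<^sup>+\<^sup>1\<close>. A convex set is contractible, so local lifts can be glued:
  pass to the complex unit circle and take a continuous logarithm.\<close>

lemma circle_map_lift:
  fixes c :: "'a::real_normed_vector \<Rightarrow> circle"
  assumes "convex S"
    and loc: "\<And>z. z \<in> S \<Longrightarrow>
      \<exists>W g. open W \<and> z \<in> W \<and> continuous_on W g \<and> (\<forall>w\<in>W \<inter> S. c w = abs_circle (g w))"
  shows "\<exists>u. continuous_on S u \<and> (\<forall>w\<in>S. abs_circle (u w) = c w)"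
proof -
  let ?e = "\<lambda>t. exp (complex_of_real (2 * pi * t) * \<i>)"
  have abs_rep: "abs_circle (rep_circle x) = x" for x
    by (rule Quotient3_abs_rep[OF Quotient3_circle])
  have e_eq: "?e s = ?e t \<longleftrightarrow> abs_circle s = abs_circle t" for s t
  proof -
    have "?e s = ?e t \<longleftrightarrow> (\<exists>n::int. complex_of_real (2 * pi * s) * \<i>
        = complex_of_real (2 * pi * t) * \<i> + (of_int (2 * n) * pi) * \<i>)"
      by (rule exp_eq)
    also have "\<dots> \<longleftrightarrow> (\<exists>n::int. 2 * pi * s = 2 * pi * (t + of_int n))"
      by (simp add: complex_eq_iff algebra_simps)
    also have "\<dots> \<longleftrightarrow> (\<exists>n::int. s - t = of_int n)"
      by (simp add: diff_eq_eq add.commute)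
    also have "\<dots> \<longleftrightarrow> s - t \<in> \<int>"
      by (auto simp: Ints_def)
    finally show ?thesis by (simp add: circle.abs_eq_iff)
  qed
  have "continuous_on S (\<lambda>w. ?e (rep_circle (c w)))"
  proof (rule continuous_on_if_locally_eq)
    fix z assume "z \<in> S"
    then obtain W g where W: "open W" "z \<in> W" "continuous_on W g"
      "\<forall>w\<in>W \<inter> S. c w = abs_circle (g w)"
      using loc by blast
    have "continuous_on W (\<lambda>w. ?e (g w))"
      by (intro continuous_intros W)
    moreover have "\<forall>w\<in>W \<inter> S. ?e (rep_circle (c w)) = ?e (g w)"
      unfolding e_eq using W(4) by (simp add: abs_rep)
    ultimately show "\<exists>W g. open W \<and> z \<in> W \<and> continuous_on W g \<and>
        (\<forall>w\<in>W \<inter> S. ?e (rep_circle (c w)) = g w)"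
      using W(1,2) by (intro exI[of _ W] exI[of _ "\<lambda>w. ?e (g w)"]) auto
  qed
  from continuous_logarithm_on_contractible[OF this convex_imp_contractible[OF assms(1)]]
  obtain g where g: "continuous_on S g" "\<And>w. w \<in> S \<Longrightarrow> ?e (rep_circle (c w)) = exp (g w)"
    by (metis exp_not_eq_zero)
  have "abs_circle (Im (g w) / (2 * pi)) = c w" if "w \<in> S" for w
  proof -
    have "norm (exp (g w)) = 1" using g(2)[OF that] by (metis norm_exp_i_times mult.commute)
    then have "Re (g w) = 0" by simp
    then have "g w = complex_of_real (2 * pi * (Im (g w) / (2 * pi))) * \<i>"
      by (simp add: complex_eq_iff)
    then have "?e (rep_circle (c w)) = ?e (Im (g w) / (2 * pi))"
      using g(2)[OF that] by metis
    then show ?thesis by (simp only: e_eq abs_rep)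
  qed
  with g(1) show ?thesis
    by (intro exI[of _ "\<lambda>w. Im (g w) / (2 * pi)"]) (auto intro!: continuous_intros)
qed

text \<open>The witness is the time-one map of the lifted isotopy. Its initial map lifts the identity, so it is a
  translation by an integer, which is subtracted; where the isotopy is stationary, the lifted one
  then stays at its starting point.\<close>

lemma ex_compact_lift:
  fixes f :: "('n::finite, circle) space \<Rightarrow> ('n, circle) space"
  assumes "contact_isotopic_to_id f"
  shows "\<exists>F. compact_lift f F"
proof -
  obtain h :: "real \<Rightarrow> ('n, circle) space \<Rightarrow> ('n, circle) space" and K
    where h: "h 0 = id" "h 1 = f" and K: "compact K" "\<forall>t\<in>{0..1}. support (h t) \<subseteq> K"
    and smooth: "\<forall>t\<in>{0..1}. \<forall>q. \<exists>W (F :: real \<times> ('n, real) space \<Rightarrow> ('n, real) space). (t, q) \<in> W \<and> smooth_on W F \<and>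
        (\<forall>(s, r)\<in>W. s \<in> {0..1} \<longrightarrow> proj (F (s, r)) = h s (proj r))"
    using assms unfolding contact_isotopic_to_id_def by (elim exE conjE) (rule that)
  define S :: "(real \<times> ('n, real) space) set" where "S = {0..1} \<times> UNIV"
  define H where "H = (\<lambda>w :: real \<times> ('n, real) space. h (fst w) (proj (snd w)))"
  have "convex S" unfolding S_def by (intro convex_Times convex_UNIV convex_real_interval)
  have loc: "\<exists>W F. open W \<and> z \<in> W \<and> continuous_on W F \<and> (\<forall>w\<in>W \<inter> S. H w = proj (F w))"
    if zS: "z \<in> S" for z
  proof -
    obtain t q where z: "z = (t, q)" "t \<in> {0..1}" using zS unfolding S_def by blast
    obtain W F where "(t, q) \<in> W" "smooth_on W F"
      "\<forall>(s, r)\<in>W. s \<in> {0..1} \<longrightarrow> proj (F (s, r)) = h s (proj r)"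
      using bspec[OF smooth z(2), THEN spec, of q] by (elim exE conjE) (rule that)
    moreover from this have "open W" "Ck_on 0 W F" unfolding smooth_on_def by blast+
    ultimately show ?thesis
      unfolding z(1) by (intro exI[of _ W] exI[of _ F]) (auto simp: S_def H_def)
  qed
  have cont_x: "continuous_on S (\<lambda>w. fst (H w))"
  proof (rule continuous_on_if_locally_eq)
    fix z assume "z \<in> S"
    with loc obtain W F where "open W" "z \<in> W" "continuous_on W F" "\<forall>w\<in>W \<inter> S. H w = proj (F w)"
      by blast
    then show "\<exists>W g. open W \<and> z \<in> W \<and> continuous_on W g \<and> (\<forall>w\<in>W \<inter> S. fst (H w) = g w)"
      by (intro exI[of _ W] exI[of _ "\<lambda>w. fst (F w)"])
         (auto intro!: continuous_intros simp: proj_sel)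
  qed
  have cont_y: "continuous_on S (\<lambda>w. fst (snd (H w)))"
  proof (rule continuous_on_if_locally_eq)
    fix z assume "z \<in> S"
    with loc obtain W F where "open W" "z \<in> W" "continuous_on W F" "\<forall>w\<in>W \<inter> S. H w = proj (F w)"
      by blast
    then show "\<exists>W g. open W \<and> z \<in> W \<and> continuous_on W g \<and> (\<forall>w\<in>W \<inter> S. fst (snd (H w)) = g w)"
      by (intro exI[of _ W] exI[of _ "\<lambda>w. fst (snd (F w))"])
         (auto intro!: continuous_intros simp: proj_sel)
  qed
  have "\<exists>u. continuous_on S u \<and> (\<forall>w\<in>S. abs_circle (u w) = theta (H w))"
  proof (rule circle_map_lift[OF \<open>convex S\<close>])
    fix z assume "z \<in> S"
    with loc obtain W F where "open W" "z \<in> W" "continuous_on W F" "\<forall>w\<in>W \<inter> S. H w = proj (F w)"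
      by blast
    then show "\<exists>W g. open W \<and> z \<in> W \<and> continuous_on W g \<and>
        (\<forall>w\<in>W \<inter> S. theta (H w) = abs_circle (g w))"
      by (intro exI[of _ W] exI[of _ "\<lambda>w. theta (F w)"])
         (auto intro!: continuous_intros simp: proj_sel)
  qed
  then obtain u where u: "continuous_on S u" "\<And>w. w \<in> S \<Longrightarrow> abs_circle (u w) = theta (H w)"
    by blast
  have stationary: "u (s, q) - theta q \<in> \<int>" if "s \<in> {0..1}" "h s (proj q) = proj q" for s q
  proof -
    have "abs_circle (u (s, q)) = abs_circle (theta q)"
      using u(2)[of "(s, q)"] that by (simp add: S_def H_def proj_sel)
    then show ?thesis by (simp add: circle.abs_eq_iff)
  qed
  have at_time: "continuous_on UNIV (\<lambda>q. k (s, q))"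
    if "continuous_on S k" "s \<in> {0..1}"
    for k :: "real \<times> ('n, real) space \<Rightarrow> 'd::topological_space" and s
    by (rule continuous_on_compose2[OF that(1)])
       (use that(2) in \<open>auto intro!: continuous_intros simp: S_def\<close>)
  have along_time: "continuous_on {0..1} (\<lambda>s. u (s, q))" for q
    by (rule continuous_on_compose2[OF u(1)]) (auto intro!: continuous_intros simp: S_def)
  define N where "N = u (0, 0)"
  have N: "u (0, q) - theta q = N" for q
  proof -
    have "u (0, q) - theta q = u (0, 0) - theta (0 :: ('n, real) space)"
    proof (rule continuous_Ints_valued_constant[of UNIV "\<lambda>q. u (0, q) - theta q"])
      show "continuous_on UNIV (\<lambda>q. u (0, q) - theta q)"
        by (intro continuous_intros at_time u(1)) simp
    qed (use stationary h(1) in auto)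
    then show ?thesis by (simp add: N_def)
  qed
  have "N \<in> \<int>" using stationary[of 0 0] N[of 0] by (simp add: h)
  define F where "F = (\<lambda>q. (fst (H (1, q)), fst (snd (H (1, q))), u (1, q) - N))"
  have "compact_lift f F"
    unfolding compact_lift_def
  proof (intro conjI allI)
    show "continuous_on UNIV F"
      unfolding F_def
      by (intro continuous_on_Pair continuous_on_diff continuous_on_const
          at_time[OF cont_x] at_time[OF cont_y] at_time[OF u(1)]) simp_all
    show "proj (F q) = f (proj q)" for q
    proof -
      have "abs_circle (u (1, q) - N) = abs_circle (u (1, q))"
        using \<open>N \<in> \<int>\<close> by (simp add: circle.abs_eq_iff)
      also have "\<dots> = theta (f (proj q))"
        using u(2)[of "(1, q)"] by (simp add: S_def H_def h)
      finally have "theta (proj (F q)) = theta (f (proj q))" by (simp add: F_def proj_sel)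
      moreover have "H (1, q) = f (proj q)" by (simp add: H_def h)
      ultimately show ?thesis by (simp add: F_def prod_eq_iff proj_sel)
    qed
    have "F q = q" if "proj q \<notin> K" for q
    proof -
      have fixed: "h s (proj q) = proj q" if "s \<in> {0..1}" for s
      proof (rule ccontr)
        assume "h s (proj q) \<noteq> proj q"
        then have "proj q \<in> support (h s)"
          unfolding support_def by (intro subsetD[OF closure_subset] CollectI)
        then show False using bspec[OF K(2) that] \<open>proj q \<notin> K\<close> by blast
      qed
      have "u (1, q) - theta q = u (0, q) - theta q"
      proof (rule continuous_Ints_valued_constant[of "{0..1}" "\<lambda>s. u (s, q) - theta q"])
        show "continuous_on {0..1} (\<lambda>s. u (s, q) - theta q)"
          by (intro continuous_on_diff continuous_on_const along_time)
      qed (use stationary fixed in auto)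
      then have "u (1, q) - N = theta q" using N[of q] by simp
      moreover have "H (1, q) = proj q" using fixed[of 1] by (simp add: H_def)
      ultimately show "F q = q" by (simp add: F_def proj_sel prod_eq_iff)
    qed
    with K(1) show "\<exists>K :: ('n, circle) space set. compact K \<and> (\<forall>q. proj q \<notin> K \<longrightarrow> F q = q)"
      by blast
  qed
  then show ?thesis by (rule exI[where x = F])
qed

lemma compact_lift_real_lift:
  assumes "contact_isotopic_to_id f"
  shows "compact_lift f (real_lift f)"
proof -
  obtain F where F: "compact_lift f F" using ex_compact_lift[OF assms] by blast
  then show ?thesis
    unfolding real_lift_eq using compact_lift_unique[OF _ F] by (rule theI)
qed


section \<open>The action over \<open>\<real>\<^sup>2\<^sup>n \<times> S\<^sup>1\<close>\<close>

text \<open>The part of the definition of a translated chain that does not mention conformal factors: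
  each point lies on the Reeb orbit of the image of its predecessor, that is, over the same point
  of \<open>\<real>\<^sup>2\<^sup>n\<close>.\<close>

definition linked ::
  "(('n, 'c) space \<Rightarrow> ('n, 'c) space) list \<Rightarrow> ('n, 'c) space list \<Rightarrow> bool" where
  "linked \<phi> p \<longleftrightarrow> length p = length \<phi> \<and> (\<forall>j<length \<phi>.
     fst (p ! (Suc j mod length \<phi>)) = fst ((\<phi> ! j) (p ! j)) \<and>
     fst (snd (p ! (Suc j mod length \<phi>))) = fst (snd ((\<phi> ! j) (p ! j))))"

lemma translated_chain_linked:
  assumes "translated_chain \<phi> p"
  shows "linked \<phi> p"
proof -
  obtain t where "length p = length \<phi>"
    "\<forall>j<length \<phi>. p ! (Suc j mod length \<phi>) = reeb_flow (- t j) ((\<phi> ! j) (p ! j))"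
    using assms unfolding translated_chain_def by blast
  then show ?thesis by (simp add: linked_def reeb_flow_sel)
qed

lemma linked_iterate:
  assumes "linked \<phi> p"
  shows "linked (iterate l \<phi>) (iterate l p)"
  unfolding linked_def
proof (intro conjI allI impI)
  let ?N = "length \<phi>"
  have len: "length p = ?N" using assms by (simp add: linked_def)
  then show "length (iterate l p) = length (iterate l \<phi>)" by simp
  fix j assume "j < length (iterate l \<phi>)"
  then have j: "j < l * ?N" by simp
  then have "?N > 0" "l * ?N > 0" by (auto intro: Nat.gr0I)
  then have j': "Suc j mod (l * ?N) < l * ?N" "j mod ?N < ?N" by simp_all
  have "Suc j mod (l * ?N) mod ?N = Suc (j mod ?N) mod ?N"
    by (simp add: mod_mod_cancel mod_Suc_eq)
  with j j' have nth: "iterate l p ! (Suc j mod length (iterate l \<phi>)) = p ! (Suc (j mod ?N) mod ?N)"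
    "(iterate l \<phi> ! j) (iterate l p ! j) = (\<phi> ! (j mod ?N)) (p ! (j mod ?N))"
    by (simp_all add: nth_iterate len)
  show "fst (iterate l p ! (Suc j mod length (iterate l \<phi>)))
      = fst ((iterate l \<phi> ! j) (iterate l p ! j))"
    and "fst (snd (iterate l p ! (Suc j mod length (iterate l \<phi>))))
      = fst (snd ((iterate l \<phi> ! j) (iterate l p ! j)))"
    unfolding nth using assms j'(2) by (simp_all add: linked_def)
qed

text \<open>In a closed chain the translation amounts \<open>\<theta> (F\<^sub>j q\<^sub>j) - \<theta> q\<^sub>j\<^sub>+\<^sub>1\<close> can be regrouped into
  terms that involve one point each.\<close>

lemma action_linked:
  assumes "linked \<psi> q"
  shows "action \<psi> q = (\<Sum>j<length \<psi>. theta ((\<psi> ! j) (q ! j)) - theta (q ! j))"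
proof -
  let ?N = "length \<psi>"
  have "(THE t. b = reeb_flow (- t) a) = theta a - theta b"
    if "fst b = fst a" "fst (snd b) = fst (snd a)" for a b :: "('a, real) space"
    using that
    by (intro the_equality)
       (auto simp: reeb_flow_real prod_eq_iff)
  then have "action \<psi> q
      = (\<Sum>j<?N. theta ((\<psi> ! j) (q ! j)) - theta (q ! (Suc j mod ?N)))"
    using assms unfolding action_def linked_def by (intro sum.cong[OF refl]) auto
  also have "\<dots> = (\<Sum>j<?N. theta ((\<psi> ! j) (q ! j))) - (\<Sum>j<?N. theta (q ! j))"
    using sum_cyclic_shift[of "\<lambda>j. theta (q ! j)" ?N] by (simp add: sum_subtractf)
  finally show ?thesis by (simp add: sum_subtractf)
qed

lemma linked_lift:
  assumes "linked \<phi> (map proj q)" and "\<And>f. f \<in> set \<phi> \<Longrightarrow> compact_lift f (real_lift f)"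
  shows "linked (map real_lift \<phi>) q"
  unfolding linked_def
proof (intro conjI allI impI)
  let ?N = "length \<phi>"
  have len: "length q = ?N" using assms(1) by (simp add: linked_def)
  then show "length q = length (map real_lift \<phi>)" by simp
  fix j assume "j < length (map real_lift \<phi>)"
  then have j: "j < ?N" "Suc j mod ?N < ?N" by (auto intro: mod_less_divisor)
  have "(\<phi> ! j) (proj (q ! j)) = proj (real_lift (\<phi> ! j) (q ! j))"
    using assms(2)[OF nth_mem[OF j(1)]] unfolding compact_lift_def by metis
  then have "fst (q ! (Suc j mod ?N)) = fst (real_lift (\<phi> ! j) (q ! j)) \<and>
      fst (snd (q ! (Suc j mod ?N))) = fst (snd (real_lift (\<phi> ! j) (q ! j)))"
    using assms(1) j len unfolding linked_def by (auto simp: proj_sel)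
  then show "fst (q ! (Suc j mod length (map real_lift \<phi>))) = fst ((map real_lift \<phi> ! j) (q ! j))"
    and "fst (snd (q ! (Suc j mod length (map real_lift \<phi>))))
      = fst (snd ((map real_lift \<phi> ! j) (q ! j)))"
    using j by simp_all
qed

text \<open>After the regrouping, the independence holds term by term, because each lifted map commutes with
  the deck translations.\<close>

lemma action_lift_independent:
  fixes q q' :: "('n::finite, real) space list"
  assumes "linked \<phi> (map proj q)" and "map proj q = (map proj q' :: ('n, circle) space list)"
    and lift: "\<And>f. f \<in> set \<phi> \<Longrightarrow> compact_lift f (real_lift f)"
  shows "action (map real_lift \<phi>) q = action (map real_lift \<phi>) q'"
proof -
  have len: "length q = length \<phi>" "length q' = length \<phi>"
    using assms(1,2) by (simp_all add: linked_def) (metis length_map)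
  have "theta (real_lift (\<phi> ! j) (q ! j)) - theta (q ! j)
      = theta (real_lift (\<phi> ! j) (q' ! j)) - theta (q' ! j)" if "j < length \<phi>" for j
  proof -
    have "(proj (q ! j) :: ('n, circle) space) = proj (q' ! j)"
      using assms(2) len that by (metis nth_map)
    then obtain z where "z \<in> \<int>" "q ! j = reeb_flow z (q' ! j)"
      using proj_eq_iff_translate by blast
    with compact_lift_equivariant[OF lift[OF nth_mem[OF that]]] show ?thesis
      by (simp add: reeb_flow_real)
  qed
  moreover have "linked (map real_lift \<phi>) q" "linked (map real_lift \<phi>) q'"
    using assms by (auto intro: linked_lift)
  ultimately show ?thesis by (simp add: action_linked)
qed

lemma action_circle_eq:
  assumes "linked \<phi> p" and "\<And>f. f \<in> set \<phi> \<Longrightarrow> compact_lift f (real_lift f)"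
    and "map proj q = p"
  shows "action_circle \<phi> p = action (map real_lift \<phi>) q"
  unfolding action_circle_def
proof (rule the_equality)
  have "action (map real_lift \<phi>) r = action (map real_lift \<phi>) q" if "map proj r = p" for r
  proof (rule action_lift_independent)
    show "linked \<phi> (map proj r)" using assms(1) that by simp
    show "map proj r = (map proj q :: ('a, circle) space list)" using assms(3) that by simp
  qed (rule assms(2))
  then show "\<forall>r. map proj r = p \<longrightarrow> action (map real_lift \<phi>) r = action (map real_lift \<phi>) q"
    by blast
qed (use assms(3) in blast)

text \<open>Most lifts of an iterated chain are not iterations of a list. Independence of the lift
  allows the computation to use one that is.\<close>

lemma action_circle_iterate:
  assumes "linked \<phi> p" and lift: "\<And>f. f \<in> set \<phi> \<Longrightarrow> compact_lift f (real_lift f)"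
  shows "action_circle (iterate l \<phi>) (iterate l p) = real l * action_circle \<phi> p"
proof -
  obtain q where q: "map proj q = p"
    using surj_proj by (metis ex_map_conv)
  have "length q = length \<phi>" using q assms(1) by (auto simp: linked_def)
  moreover have "action_circle (iterate l \<phi>) (iterate l p)
      = action (map real_lift (iterate l \<phi>)) (iterate l q)"
    using set_iterate_subset[of l \<phi>]
    by (intro action_circle_eq linked_iterate assms) (auto simp: q map_iterate)
  ultimately show ?thesis
    by (simp add: map_iterate action_iterate action_circle_eq[OF assms q])
qed

lemma bij_rotate: "bij (rotate k :: 'a list \<Rightarrow> 'a list)"
  unfolding rotate_def by (rule bij_fn[OF bij_rotate1])

text \<open>Every lift of the rotated list is the rotation of a lift of the original one, and the two
  lifts have the same action. So the values of \<open>a\<close> admitted in the definition of the action are the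
  same for both lists.\<close>

lemma action_circle_rotate1_tuples:
  fixes P :: "('n::finite, circle) space list list"
  assumes len: "\<forall>p\<in>set P. length p = length \<phi>" "length P = m"
  shows "action_circle (iterate m \<phi>) (concat (rotate1 P)) = action_circle (iterate m \<phi>) (concat P)"
proof -
  let ?\<psi> = "map real_lift (iterate m \<phi>)"
  let ?k = "length \<phi>"
  have lenP: "length (concat P) = m * ?k"
    using len by (induction P arbitrary: m) auto
  have act: "action ?\<psi> (rotate ?k q) = action ?\<psi> q" if "map proj q = concat P" for q
  proof -
    have "length q = length ?\<psi>" using lenP that by (metis length_iterate length_map)
    then have "action (rotate ?k ?\<psi>) (rotate ?k q) = action ?\<psi> q"
      by (rule action_rotate)
    then show ?thesis by (simp only: rotate_map rotate_iterate)
  qed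
  have "(\<forall>q. map proj q = rotate ?k (concat P) \<longrightarrow> action ?\<psi> q = a)
      \<longleftrightarrow> (\<forall>q. map proj q = concat P \<longrightarrow> action ?\<psi> q = a)" for a
  proof safe
    fix q assume "\<forall>q. map proj q = rotate ?k (concat P) \<longrightarrow> action ?\<psi> q = a"
      and q: "map proj q = concat P"
    then have "action ?\<psi> (rotate ?k q) = a" by (metis rotate_map)
    then show "action ?\<psi> q = a" using act[OF q] by simp
  next
    fix q assume *: "\<forall>q. map proj q = concat P \<longrightarrow> action ?\<psi> q = a"
      and q: "map proj q = rotate ?k (concat P)"
    obtain r where r: "q = rotate ?k r" using bij_rotate by (metis bij_pointE)
    then have "rotate ?k (map proj r) = rotate ?k (concat P)" using q by (simp add: rotate_map)
    then have "map proj r = concat P" using bij_rotate by (metis bij_pointE)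
    then show "action ?\<psi> q = a" using * act r by metis
  qed
  then show ?thesis
    unfolding action_circle_def concat_rotate1[OF len(1)] by simp
qed


section \<open>Invariance of the mean action\<close>

lemma equivclp_invariant:
  assumes "equivclp R x y" and "\<And>u v. R u v \<Longrightarrow> A u = A v"
  shows "A x = A y"
  using assms(1) by (induction rule: equivclp_induct) (auto dest: assms(2))

lemma mean_action_invariant:
  assumes "rotation_or_iteration \<phi> P Q"
  shows "1 / real (length P) * action (iterate (length P) \<phi>) (concat P)
    = 1 / real (length Q) * action (iterate (length Q) \<phi>) (concat Q)"
proof -
  let ?m = "length P"
  have chain: "\<forall>p\<in>set P. length p = length \<phi>" "length (concat P) = length (iterate ?m \<phi>)"
    using assms unfolding rotation_or_iteration_def periodic_translated_chain_def
      translated_chain_def by auto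
  consider "Q = rotate1 P" | l where "l \<ge> 1" "Q = iterate l P"
    using assms unfolding rotation_or_iteration_def by blast
  then show ?thesis
  proof cases
    case 1
    then show ?thesis using action_rotate1_tuples[OF chain(1) refl] by simp
  next
    case 2
    then show ?thesis
      using action_iterate[OF chain(2), of l] by (simp add: concat_iterate iterate_iterate)
  qed
qed

lemma mean_action_circle_invariant:
  assumes "admissible \<phi>" and "rotation_or_iteration \<phi> P Q"
  shows "1 / real (length P) * action_circle (iterate (length P) \<phi>) (concat P)
    = 1 / real (length Q) * action_circle (iterate (length Q) \<phi>) (concat Q)"
proof -
  let ?m = "length P"
  have chain: "\<forall>p\<in>set P. length p = length \<phi>" "linked (iterate ?m \<phi>) (concat P)"
    using assms(2) unfolding rotation_or_iteration_def periodic_translated_chain_def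
    by (auto intro: translated_chain_linked)
  have lift: "compact_lift f (real_lift f)" if "f \<in> set (iterate ?m \<phi>)" for f
    using assms(1) that set_iterate_subset[of ?m \<phi>] compact_lift_real_lift
    unfolding admissible_def by blast
  consider "Q = rotate1 P" | l where "l \<ge> 1" "Q = iterate l P"
    using assms(2) unfolding rotation_or_iteration_def by blast
  then show ?thesis
  proof cases
    case 1
    then show ?thesis using action_circle_rotate1_tuples[OF chain(1) refl] by simp
  next
    case 2
    then show ?thesis
      using action_circle_iterate[OF chain(2) lift, of l]
      by (simp add: concat_iterate iterate_iterate)
  qed
qed

theorem lemma1p4:
  shows
    "(\<forall>(\<phi> :: (('n::finite, real) space \<Rightarrow> ('n, real) space) list) m1 m2 P1 P2.
        admissible \<phi> \<longrightarrow>
        periodic_translated_chain \<phi> m1 P1 \<longrightarrow>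
        periodic_translated_chain \<phi> m2 P2 \<longrightarrow>
        1 / real m1 * action (iterate m1 \<phi>) (concat P1)
          \<noteq> 1 / real m2 * action (iterate m2 \<phi>) (concat P2) \<longrightarrow>
        geometrically_distinct \<phi> P1 P2)
     \<and>
     (\<forall>(\<phi> :: (('n::finite, circle) space \<Rightarrow> ('n, circle) space) list) m1 m2 P1 P2.
        admissible \<phi> \<longrightarrow>
        periodic_translated_chain \<phi> m1 P1 \<longrightarrow>
        periodic_translated_chain \<phi> m2 P2 \<longrightarrow>
        1 / real m1 * action_circle (iterate m1 \<phi>) (concat P1)
          \<noteq> 1 / real m2 * action_circle (iterate m2 \<phi>) (concat P2) \<longrightarrow>
        geometrically_distinct \<phi> P1 P2)"

proof (intro conjI allI impI)
  fix \<phi> :: "(('n, real) space \<Rightarrow> ('n, real) space) list" and m1 m2 P1 P2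
  assume chains: "periodic_translated_chain \<phi> m1 P1" "periodic_translated_chain \<phi> m2 P2"
    and neq: "1 / real m1 * action (iterate m1 \<phi>) (concat P1)
      \<noteq> 1 / real m2 * action (iterate m2 \<phi>) (concat P2)"
  have m: "m1 = length P1" "m2 = length P2"
    using chains by (simp_all add: periodic_translated_chain_def)
  let ?A = "\<lambda>P. 1 / real (length P) * action (iterate (length P) \<phi>) (concat P)"
  show "geometrically_distinct \<phi> P1 P2"
    unfolding geometrically_distinct_def
  proof
    assume "equivclp (rotation_or_iteration \<phi>) P1 P2"
    then have "?A P1 = ?A P2"
      by (rule equivclp_invariant) (rule mean_action_invariant)
    with neq show False by (simp only: m)
  qed
next
  fix \<phi> :: "(('n, circle) space \<Rightarrow> ('n, circle) space) list" and m1 m2 P1 P2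
  assume adm: "admissible \<phi>"
    and chains: "periodic_translated_chain \<phi> m1 P1" "periodic_translated_chain \<phi> m2 P2"
    and neq: "1 / real m1 * action_circle (iterate m1 \<phi>) (concat P1)
      \<noteq> 1 / real m2 * action_circle (iterate m2 \<phi>) (concat P2)"
  have m: "m1 = length P1" "m2 = length P2"
    using chains by (simp_all add: periodic_translated_chain_def)
  let ?A = "\<lambda>P. 1 / real (length P) * action_circle (iterate (length P) \<phi>) (concat P)"
  show "geometrically_distinct \<phi> P1 P2"
    unfolding geometrically_distinct_def
  proof
    assume "equivclp (rotation_or_iteration \<phi>) P1 P2"
    then have "?A P1 = ?A P2"
      by (rule equivclp_invariant) (rule mean_action_circle_invariant[OF adm])
    with neq show False by (simp only: m)
  qed
qed

end
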